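(* Let $R_n$ be the Galois ring of characteristic $4$ and cardinality $4^n$, let $\Gamma(R_n)$ be its Teichmüller set, made into the field $(\Gamma(R_n),\oplus,\cdot)$ with $2^n$ elements via $x\oplus y=x+y+2\sqrt{xy}$. Let $f:\Gamma(R_n)\to\Gamma(R_n)$ be any function and put $D=\{x+2\sqrt{f(x)}:x\in\Gamma(R_n)\}\subseteq R_n$. Then $D$ is a relative difference set in the additive group of $R_n$ with parameters $(2^n,2^n,2^n,1)$ and forbidden subgroup $2R_n$ if and only if $f$ is planar (as a function on the field $(\Gamma(R_n),\oplus,\cdot)$).
   Context: The unit group $R_n\setminus 2R_n$ of $R_n$ contains a cyclic subgroup $\Gamma(R_n)^*$ of order $2^n-1$, and $\Gamma(R_n)=\Gamma(R_n)^*\cup\{0\}$ is the Teichmüller set. With addition $x\oplus y=x+y+2\sqrt{xy}$ (here $+$ is addition in $R_n$ and $\sqrt{z}$ denotes the unique square root of $z$ in $\Gamma(R_n)$, where squaring is multiplication in $R_n$) and the ring multiplication, $\Gamma(R_n)$ is a field with $2^n$ elements. A subset $D$ of a finite group $G$ is a relative difference set with parameters $(|G|/|N|,|N|,|D|,\lambda)$ and forbidden subgroup $N$ if the list of nonzero differences of elements of $D$ contains every element of $G\setminus N$ exactly $\lambda$ times (and no element of $N\setminus\{0\}$). A function $f$ on a field $K$ of characteristic $2$ (with addition $\oplus$) is planar if for each nonzero $\epsilon\in K$ the map $x\mapsto f(x\oplus\epsilon)\oplus f(x)\oplus\epsilon x$ is a permutation of $K$. *)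

theory Defs
  imports "HOL-Algebra.Algebra"
begin

text \<open>A Galois ring is a finite commutative ring with identity in which the zero divisors,
  together with \<open>0\<close>, form the principal ideal generated by \<open>p \<cdot> 1\<close> for some prime \<open>p\<close>. Up to
  isomorphism it is determined by its characteristic and its cardinality.\<close>

definition galois_ring :: "('a, 'b) ring_scheme \<Rightarrow> bool" where
  "galois_ring R \<longleftrightarrow>
     cring R \<and> finite (carrier R) \<and>
     (\<exists>p::nat. Factorial_Ring.prime p \<and>
        {a \<in> carrier R. a = \<zero>\<^bsub>R\<^esub> \<or> (\<exists>b \<in> carrier R - {\<zero>\<^bsub>R\<^esub>}. a \<otimes>\<^bsub>R\<^esub> b = \<zero>\<^bsub>R\<^esub>)}
          = PIdl\<^bsub>R\<^esub> (add_pow R p \<one>\<^bsub>R\<^esub>))"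

definition ring_char :: "('a, 'b) ring_scheme \<Rightarrow> nat" where
  "ring_char R = group.ord (add_monoid R) \<one>\<^bsub>R\<^esub>"

text \<open>In the following definitions \<open>R\<close> is meant to be the Galois ring of characteristic \<open>4\<close> and
  cardinality \<open>4 ^ n\<close>. Its unit group has order \<open>2 ^ n * (2 ^ n - 1)\<close> and exactly one cyclic
  subgroup of order \<open>2 ^ n - 1\<close>, so the definite description is well defined. The same holds
  for the square root of an element of the Teichmueller set.\<close>

definition teichmueller_units :: "('a, 'b) ring_scheme \<Rightarrow> nat \<Rightarrow> 'a set" where
  "teichmueller_units R n =
     (THE T. subgroup T (units_of R) \<and> cyclic_group ((units_of R)\<lparr>carrier := T\<rparr>) \<and>
             card T = 2 ^ n - 1)"

definition teichmueller_set :: "('a, 'b) ring_scheme \<Rightarrow> nat \<Rightarrow> 'a set" where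
  "teichmueller_set R n = teichmueller_units R n \<union> {\<zero>\<^bsub>R\<^esub>}"

definition teichmueller_sqrt :: "('a, 'b) ring_scheme \<Rightarrow> nat \<Rightarrow> 'a \<Rightarrow> 'a" where
  "teichmueller_sqrt R n z = (THE w. w \<in> teichmueller_set R n \<and> w \<otimes>\<^bsub>R\<^esub> w = z)"

definition teichmueller_field :: "('a, 'b) ring_scheme \<Rightarrow> nat \<Rightarrow> 'a ring" where
  "teichmueller_field R n =
     \<lparr>carrier = teichmueller_set R n, monoid.mult = monoid.mult R, monoid.one = \<one>\<^bsub>R\<^esub>, ring.zero = \<zero>\<^bsub>R\<^esub>,
      ring.add = (\<lambda>x y. x \<oplus>\<^bsub>R\<^esub> y \<oplus>\<^bsub>R\<^esub> add_pow R (2::nat) (teichmueller_sqrt R n (x \<otimes>\<^bsub>R\<^esub> y)))\<rparr>"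

text \<open>The group is written multiplicatively, as in HOL-Algebra, so the difference of \<open>x\<close> and
  \<open>y\<close> is \<open>x \<otimes> inv y\<close>. The parameters are \<open>m = |G| / |N|\<close>, \<open>k = |N|\<close>, \<open>d = |D|\<close> and \<open>l\<close>;
  the division is exact by Lagrange's theorem.\<close>

definition relative_difference_set ::
  "('a, 'b) monoid_scheme \<Rightarrow> 'a set \<Rightarrow> 'a set \<Rightarrow> nat \<times> nat \<times> nat \<times> nat \<Rightarrow> bool" where
  "relative_difference_set G N D = (\<lambda>(m, k, d, l).
     group G \<and> finite (carrier G) \<and> subgroup N G \<and> D \<subseteq> carrier G \<and>
     m = order G div card N \<and> k = card N \<and> d = card D \<and>
     (\<forall>g \<in> carrier G - N. card {(x, y) \<in> D \<times> D. x \<otimes>\<^bsub>G\<^esub> inv\<^bsub>G\<^esub> y = g} = l) \<and>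
     (\<forall>g \<in> N - {\<one>\<^bsub>G\<^esub>}. card {(x, y) \<in> D \<times> D. x \<otimes>\<^bsub>G\<^esub> inv\<^bsub>G\<^esub> y = g} = 0))"

text \<open>The field \<open>K\<close> is meant to have characteristic \<open>2\<close>.\<close>

definition planar :: "('a, 'b) ring_scheme \<Rightarrow> ('a \<Rightarrow> 'a) \<Rightarrow> bool" where
  "planar K f \<longleftrightarrow>
     (\<forall>\<epsilon> \<in> carrier K - {\<zero>\<^bsub>K\<^esub>}.
        bij_betw (\<lambda>x. f (x \<oplus>\<^bsub>K\<^esub> \<epsilon>) \<oplus>\<^bsub>K\<^esub> f x \<oplus>\<^bsub>K\<^esub> \<epsilon> \<otimes>\<^bsub>K\<^esub> x) (carrier K) (carrier K))"

end

theory Submission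
  imports Defs
begin

text \<open>Write \<open>q = 2 ^ n\<close>. Doubling has kernel and image \<open>2R\<close>, so \<open>2x = 2y\<close> expresses congruence
  modulo \<open>2R\<close>; the residue field has \<open>q\<close> elements, congruent elements have equal squares, and the
  Teichmueller set consists of the solutions of \<open>x ^ q = x\<close>, one in each residue class.

  Every \<open>g\<close> outside \<open>2R\<close> is \<open>\<epsilon> + 2b\<close> with \<open>\<epsilon> \<noteq> 0\<close> and \<open>b\<close> in the Teichmueller set. If the difference
  of the points of \<open>D\<close> over \<open>x\<close> and \<open>y\<close> is \<open>g\<close>, then reduction modulo \<open>2R\<close> forces \<open>x\<close> to be the field
  sum of \<open>y\<close> and \<open>\<epsilon>\<close>. What remains is the congruence
  \<open>sqrt (f x) + sqrt (f y) + sqrt (\<epsilon> * y) = b\<close> modulo \<open>2R\<close>, and squaring turns it into the equation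
  that the planar map of \<open>\<epsilon>\<close> takes the value \<open>b ^ 2\<close> at \<open>y\<close>. So \<open>g\<close> is a difference exactly once
  for all \<open>b\<close> if and only if this map is a permutation.\<close>

text \<open>Difference sets count representations while planarity asks for a permutation; this is
  the interface between the two.\<close>

lemma bij_betw_iff_card_fibres:
  assumes "h \<in> A \<rightarrow> B"
  shows "bij_betw h A B \<longleftrightarrow> (\<forall>z \<in> B. card {y \<in> A. h y = z} = 1)"
proof
  assume h: "bij_betw h A B"
  show "\<forall>z \<in> B. card {y \<in> A. h y = z} = 1"
  proof
    fix z assume "z \<in> B"
    with h obtain x where "x \<in> A" "h x = z"
      by (auto simp: bij_betw_def)
    with h have "{y \<in> A. h y = z} = {x}"
      by (auto simp: bij_betw_def inj_on_def)
    then show "card {y \<in> A. h y = z} = 1"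
      by simp
  qed
next
  assume fib: "\<forall>z \<in> B. card {y \<in> A. h y = z} = 1"
  have fib_ex1: "\<exists>!y. y \<in> A \<and> h y = z" if "z \<in> B" for z
  proof -
    obtain x where "{y \<in> A. h y = z} = {x}"
      using fib \<open>z \<in> B\<close> by (metis card_1_singletonE)
    then show ?thesis
      by (auto simp: set_eq_iff)
  qed
  show "bij_betw h A B"
  proof (rule bij_betw_imageI)
    show "inj_on h A"
      using assms fib_ex1 by (intro inj_onI) (metis PiE)
    show "h ` A = B"
      using assms fib_ex1 by blast
  qed
qed

section \<open>Doubling and the ideal \<open>2R\<close>\<close>

locale galois_ring_char4 = cring R for R (structure) +
  fixes n :: nat
  assumes galois: "galois_ring R"
    and char4: "ring_char R = 4"
    and card_carrier: "card (carrier R) = 4 ^ n"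
begin

text \<open>Equality of doubles serves as congruence modulo \<open>two_ideal\<close>, which keeps
  most of the argument free of cosets.\<close>

definition dbl :: "'a \<Rightarrow> 'a" where
  "dbl x = x \<oplus> x"

abbreviation two_ideal :: "'a set" where
  "two_ideal \<equiv> PIdl (add_pow R (2::nat) \<one>)"

text \<open>The equation replaces the description by a cyclic unit group;
  \<open>teichmueller_set_eq\<close> identifies the two.\<close>

definition teich :: "'a set" where
  "teich = {x \<in> carrier R. x [^] (2 ^ n :: nat) = x}"

lemma finite_carrier: "finite (carrier R)"
  using galois by (simp add: galois_ring_def)

lemma dbl_closed [simp, intro]: "x \<in> carrier R \<Longrightarrow> dbl x \<in> carrier R"
  by (simp add: dbl_def)

lemma dbl_zero [simp]: "dbl \<zero> = \<zero>"
  by (simp add: dbl_def)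

lemma add_pow_two: "x \<in> carrier R \<Longrightarrow> add_pow R (2::nat) x = dbl x"
  by (simp add: dbl_def numeral_2_eq_2)

lemma dbl_add: "\<lbrakk>x \<in> carrier R; y \<in> carrier R\<rbrakk> \<Longrightarrow> dbl (x \<oplus> y) = dbl x \<oplus> dbl y"
  by (simp add: dbl_def add.m_ac)

lemma dbl_mult_l: "\<lbrakk>x \<in> carrier R; y \<in> carrier R\<rbrakk> \<Longrightarrow> dbl x \<otimes> y = dbl (x \<otimes> y)"
  by (simp add: dbl_def l_distr)

lemma dbl_mult_r: "\<lbrakk>x \<in> carrier R; y \<in> carrier R\<rbrakk> \<Longrightarrow> x \<otimes> dbl y = dbl (x \<otimes> y)"
  by (simp add: dbl_def r_distr)

lemma dbl_minus: "x \<in> carrier R \<Longrightarrow> dbl (\<ominus> x) = \<ominus> dbl x"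
  by (simp add: dbl_def minus_add)

lemma four_eq_zero: "add_pow R (4::nat) \<one> = \<zero>"
  using char4 add.pow_eq_id[of \<one> 4] by (simp add: ring_char_def)

lemma two_neq_zero: "add_pow R (2::nat) \<one> \<noteq> \<zero>"
  using char4 add.pow_eq_id[of \<one> 2] by (simp add: ring_char_def)

lemma one_neq_zero: "\<one> \<noteq> \<zero>"
  using two_neq_zero by (auto simp: add_pow_two)

lemma dbl_dbl [simp]:
  assumes "x \<in> carrier R" shows "dbl (dbl x) = \<zero>"
proof -
  have "dbl (dbl \<one>) = add_pow R (4::nat) \<one>"
    by (simp add: dbl_def numeral_eq_Suc add.m_assoc)
  then have "dbl (dbl \<one>) = \<zero>"
    by (simp add: four_eq_zero)
  then have "dbl (dbl \<one>) \<otimes> x = \<zero>"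
    using assms by simp
  then show ?thesis
    using assms by (simp add: dbl_mult_l)
qed

lemma minus_dbl: "x \<in> carrier R \<Longrightarrow> \<ominus> dbl x = dbl x"
  using dbl_dbl[of x] by (intro minus_equality) (simp_all add: dbl_def[of "dbl x"])

lemma n_pos: "n > 0"
proof (rule ccontr)
  assume "\<not> n > 0"
  then have "card (carrier R) = 1"
    using card_carrier by simp
  then show False
    using one_neq_zero one_closed zero_closed by (metis card_1_singletonE singletonD)
qed

lemma two_ideal_eq: "two_ideal = dbl ` carrier R"
  by (auto simp: cgenideal_def add_pow_two dbl_mult_r) (metis dbl_mult_r one_closed r_one)

lemma two_ideal_subset: "two_ideal \<subseteq> carrier R"
  by (auto simp: two_ideal_eq)

lemma ideal_two_ideal: "ideal two_ideal R"
  by (rule cgenideal_ideal) simp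

text \<open>The definition of a Galois ring leaves the prime \<open>p\<close> open. Here 2 is a zero
  divisor because 2 * 2 = 0, and this forces \<open>p = 2\<close>.\<close>

lemma zero_divisors_eq:
  "{a \<in> carrier R. a = \<zero> \<or> (\<exists>b \<in> carrier R - {\<zero>}. a \<otimes> b = \<zero>)} = two_ideal"
    (is "?Z = _")
proof -
  obtain p :: nat where p: "Factorial_Ring.prime p" "?Z = PIdl (add_pow R p \<one>)"
    using galois unfolding galois_ring_def by blast
  have "p = 2"
  proof (rule ccontr)
    assume "p \<noteq> 2"
    then have "odd p"
      using p(1) primes_dvd_imp_eq two_is_prime_nat by blast
    then obtain k where k: "p = 2 * k + 1"
      by (rule oddE)
    \<comment> \<open>\<open>d\<close> is the multiple \<open>p - 1\<close> of 1. The ideal contains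
      both \<open>p\<close> and \<open>d\<close>, hence 1, which is no zero divisor.\<close>
    define d where "d = add_pow R k \<one> \<otimes> dbl \<one>"
    have "dbl \<one> \<in> carrier R - {\<zero>}" "dbl \<one> \<otimes> dbl \<one> = \<zero>"
      using two_neq_zero by (simp_all add: add_pow_two dbl_mult_l)
    then have two: "dbl \<one> \<in> ?Z"
      by blast
    have ideal_Z: "ideal ?Z R"
      unfolding p(2) by (rule cgenideal_ideal) simp
    have d: "d \<in> carrier R" "d \<in> ?Z"
      using ideal.I_l_closed[OF ideal_Z two] by (simp_all add: d_def)
    have "add_pow R p \<one> = d \<oplus> \<one>"
      unfolding k by (simp add: d_def mult_2 add.nat_pow_mult[symmetric] r_distr dbl_def)
    then have "d \<oplus> \<one> \<in> ?Z"
      using cgenideal_self[of "add_pow R p \<one>"] d(1) unfolding p(2) by simp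
    then have "(d \<oplus> \<one>) \<ominus> d \<in> ?Z"
      unfolding a_minus_def
      by (rule additive_subgroup.a_closed[OF ideal.axioms(1)[OF ideal_Z] _
            additive_subgroup.a_inv_closed[OF ideal.axioms(1)[OF ideal_Z] d(2)]])
    moreover have "(d \<oplus> \<one>) \<ominus> d = \<one>"
      using d(1) by (simp add: a_minus_def add.m_comm[of d] add.m_assoc r_neg)
    ultimately have "\<one> \<in> ?Z"
      by simp
    then show False
      using one_neq_zero by auto
  qed
  then show ?thesis
    using p(2) by simp
qed

text \<open>\<open>dbl x\<close> is the product of \<open>x\<close> with the nonzero
  \<open>dbl \<one>\<close>, so a vanishing double makes \<open>x\<close> zero or a zero divisor;
  conversely, doubling twice gives 0.\<close>

lemma dbl_eq_zero_iff:
  assumes "x \<in> carrier R" shows "dbl x = \<zero> \<longleftrightarrow> x \<in> two_ideal"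
proof
  assume "dbl x = \<zero>"
  then have "x \<otimes> dbl \<one> = \<zero>"
    using assms by (simp add: dbl_mult_r)
  moreover have "dbl \<one> \<noteq> \<zero>"
    using two_neq_zero by (simp add: add_pow_two)
  ultimately have "x \<in> {a \<in> carrier R. a = \<zero> \<or> (\<exists>b \<in> carrier R - {\<zero>}. a \<otimes> b = \<zero>)}"
    using assms by auto
  then show "x \<in> two_ideal"
    by (simp only: zero_divisors_eq)
qed (auto simp: two_ideal_eq)

lemma dbl_eq_iff:
  assumes "x \<in> carrier R" "y \<in> carrier R"
  shows "dbl x = dbl y \<longleftrightarrow> x \<ominus> y \<in> two_ideal"
proof -
  have "dbl x = dbl y \<longleftrightarrow> dbl x \<ominus> dbl y = \<zero>"
    using assms by simp
  also have "dbl x \<ominus> dbl y = dbl (x \<ominus> y)"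
    using assms by (simp add: a_minus_def dbl_add dbl_minus)
  finally show ?thesis
    using assms by (simp add: dbl_eq_zero_iff)
qed

lemma dbl_eq_obtain:
  assumes "x \<in> carrier R" "y \<in> carrier R" "dbl x = dbl y"
  obtains r where "r \<in> carrier R" "x = y \<oplus> dbl r"
proof -
  have "x \<ominus> y \<in> two_ideal"
    using assms dbl_eq_iff by simp
  then obtain r where r: "r \<in> carrier R" "x \<ominus> y = dbl r"
    by (auto simp: two_ideal_eq)
  have "x = y \<oplus> (x \<ominus> y)"
    using assms(1,2) by (simp add: a_minus_def add.m_lcomm[of y x] r_neg)
  with r that show thesis
    by simp
qed

text \<open>Doubling is additive with kernel and image both equal to \<open>two_ideal\<close>, so
  the order of \<open>R\<close> is the square of this cardinality.\<close>

lemma card_two_ideal: "card two_ideal = 2 ^ n"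
proof -
  \<comment> \<open>\<open>s\<close> chooses a half of each \<open>m\<close>; adding kernel elements
    to \<open>s m\<close> fills the fibre of doubling over \<open>m\<close>.\<close>
  define s where "s = inv_into (carrier R) dbl"
  have s: "s m \<in> carrier R \<and> dbl (s m) = m" if "m \<in> two_ideal" for m
    using that unfolding two_ideal_eq s_def by (simp add: inv_into_into f_inv_into_f)
  have sub: "k \<in> carrier R \<and> dbl k = \<zero>" if "k \<in> two_ideal" for k
    using that two_ideal_subset dbl_eq_zero_iff by blast
  have "bij_betw (\<lambda>(m, k). s m \<oplus> k) (two_ideal \<times> two_ideal) (carrier R)"
  proof (rule bij_betwI')
    fix a b assume ab: "a \<in> two_ideal \<times> two_ideal" "b \<in> two_ideal \<times> two_ideal"
    obtain m k m' k' where eq: "a = (m, k)" "b = (m', k')"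
      by (metis surj_pair)
    have *: "dbl (s i \<oplus> j) = i" if "i \<in> two_ideal" "j \<in> two_ideal" for i j
      using s[OF that(1)] sub[OF that(2)] sub[OF that(1)] by (simp add: dbl_add)
    show "((case a of (m, k) \<Rightarrow> s m \<oplus> k) = (case b of (m, k) \<Rightarrow> s m \<oplus> k)) = (a = b)"
      using ab *[of m k] *[of m' k'] s[of m] s[of m'] sub[of k] sub[of k'] by (auto simp: eq)
  next
    fix a assume "a \<in> two_ideal \<times> two_ideal"
    then show "(case a of (m, k) \<Rightarrow> s m \<oplus> k) \<in> carrier R"
      using s sub by auto
  next
    fix x assume x: "x \<in> carrier R"
    then have "dbl x \<in> two_ideal"
      by (simp add: two_ideal_eq)
    moreover from s[OF this] x obtain r where "r \<in> carrier R" "x = s (dbl x) \<oplus> dbl r"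
      by (metis dbl_eq_obtain)
    ultimately show "\<exists>a \<in> two_ideal \<times> two_ideal. x = (case a of (m, k) \<Rightarrow> s m \<oplus> k)"
      by (intro bexI[of _ "(dbl x, dbl r)"]) (auto simp: two_ideal_eq)
  qed
  then have "(card two_ideal)\<^sup>2 = 4 ^ n"
    using card_carrier by (metis bij_betw_same_card card_cartesian_product power2_eq_square)
  also have "\<dots> = ((2::nat) ^ n)\<^sup>2"
    by (simp add: power2_eq_square flip: power_mult_distrib)
  finally show ?thesis
    by simp
qed

section \<open>Units and the residue field\<close>

text \<open>Multiplication by an element that is no zero divisor is injective, hence surjective on
  the finite carrier, and reaches 1.\<close>

lemma Units_iff:
  assumes "x \<in> carrier R" shows "x \<in> Units R \<longleftrightarrow> x \<notin> two_ideal"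
proof
  assume x: "x \<in> Units R"
  show "x \<notin> two_ideal"
  proof
    assume "x \<in> two_ideal"
    then have "dbl x = \<zero>"
      using assms dbl_eq_zero_iff by blast
    then have "x \<otimes> dbl \<one> = x \<otimes> \<zero>"
      using assms by (simp add: dbl_mult_r)
    then have "dbl \<one> = \<zero>"
      using x Units_l_cancel[of x "dbl \<one>" \<zero>] by blast
    then show False
      using two_neq_zero by (simp add: add_pow_two)
  qed
next
  assume x: "x \<notin> two_ideal"
  have "inj_on (\<lambda>y. x \<otimes> y) (carrier R)"
  proof (rule inj_onI)
    fix y z assume yz: "y \<in> carrier R" "z \<in> carrier R" "x \<otimes> y = x \<otimes> z"
    then have "x \<otimes> (y \<ominus> z) = \<zero>"
      using assms by (simp add: a_minus_def r_distr r_minus r_neg)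
    then have "y \<ominus> z = \<zero>"
      using x yz assms unfolding zero_divisors_eq[symmetric] by auto
    then show "y = z"
      using yz by simp
  qed
  then have "(\<lambda>y. x \<otimes> y) ` carrier R = carrier R"
    using assms by (intro endo_inj_surj finite_carrier) auto
  then obtain y where "y \<in> carrier R" "x \<otimes> y = \<one>"
    by (metis imageE one_closed)
  then show "x \<in> Units R"
    using assms unit_factor[of x y] by simp
qed

text \<open>Outside \<open>two_ideal\<close> there are only units, so a strictly larger ideal is
  everything.\<close>

lemma maximal_two_ideal: "maximalideal two_ideal R"
proof (rule maximalidealI[OF ideal_two_ideal])
  show "carrier R \<noteq> two_ideal"
    using Units_iff[of \<one>] by auto
next
  fix J assume J: "ideal J R" "two_ideal \<subseteq> J" "J \<subseteq> carrier R"
  interpret J: ideal J R by fact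
  show "J = two_ideal \<or> J = carrier R"
  proof (rule disjCI)
    assume "J \<noteq> carrier R"
    moreover have "J = carrier R" if "x \<in> J" "x \<in> Units R" for x
      using that J.I_r_closed[of x "inv x"] J.one_imp_carrier by simp
    ultimately show "J = two_ideal"
      using J Units_iff by blast
  qed
qed

lemma coset_eq_iff:
  "\<lbrakk>x \<in> carrier R; y \<in> carrier R\<rbrakk> \<Longrightarrow> two_ideal +> x = two_ideal +> y \<longleftrightarrow> dbl x = dbl y"
  by (simp add: dbl_eq_iff quotient_eq_iff_same_a_r_cos[OF ideal_two_ideal])

sublocale residue: field "R Quot two_ideal"
  by (rule maximalideal.quotient_is_field[OF maximal_two_ideal]) (rule is_cring)

lemma residue_carrier: "carrier (R Quot two_ideal) = (\<lambda>x. two_ideal +> x) ` carrier R"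
  by (auto simp: FactRing_def A_RCOSETS_def')

text \<open>A coset is determined by the common double of its members, and these doubles run through
  \<open>two_ideal\<close>.\<close>

lemma card_residue: "card (carrier (R Quot two_ideal)) = 2 ^ n"
proof -
  define h where "h = inv_into (carrier R) dbl"
  have h: "h m \<in> carrier R \<and> dbl (h m) = m" if "m \<in> two_ideal" for m
    using that unfolding two_ideal_eq h_def by (simp add: inv_into_into f_inv_into_f)
  have "bij_betw (\<lambda>m. two_ideal +> h m) two_ideal (carrier (R Quot two_ideal))"
  proof (rule bij_betw_imageI)
    show "inj_on (\<lambda>m. two_ideal +> h m) two_ideal"
      using h by (auto simp: inj_on_def coset_eq_iff)
    show "(\<lambda>m. two_ideal +> h m) ` two_ideal = carrier (R Quot two_ideal)"
    proof (intro equalityI subsetI)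
      fix c assume "c \<in> carrier (R Quot two_ideal)"
      then obtain x where x: "x \<in> carrier R" "c = two_ideal +> x"
        by (auto simp: residue_carrier)
      then have "dbl x \<in> two_ideal"
        by (simp add: two_ideal_eq)
      moreover from h[OF this] x have "c = two_ideal +> h (dbl x)"
        by (simp add: coset_eq_iff)
      ultimately show "c \<in> (\<lambda>m. two_ideal +> h m) ` two_ideal"
        by blast
    qed (use h in \<open>auto simp: residue_carrier\<close>)
  qed
  then show ?thesis
    by (simp add: bij_betw_same_card[symmetric] card_two_ideal)
qed

lemma finite_residue: "finite (carrier (R Quot two_ideal))"
  by (simp add: residue_carrier finite_carrier)

lemma coset_nat_pow:
  "x \<in> carrier R \<Longrightarrow> (two_ideal +> x) [^]\<^bsub>R Quot two_ideal\<^esub> (k::nat) = two_ideal +> (x [^] k)"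
  using ring_hom_ring.hom_nat_pow[OF ideal.rcos_ring_hom_ring[OF ideal_two_ideal], of x k] by simp

text \<open>Lagrange in the multiplicative group of order \<open>2 ^ n - 1\<close>, times one more
  factor \<open>c\<close>; 0 lies outside that group.\<close>

lemma residue_pow_card:
  assumes "c \<in> carrier (R Quot two_ideal)"
  shows "c [^]\<^bsub>R Quot two_ideal\<^esub> (2 ^ n :: nat) = c"
proof (cases "c = \<zero>\<^bsub>R Quot two_ideal\<^esub>")
  case True
  then show ?thesis
    by (simp add: residue.nat_pow_zero)
next
  case False
  interpret M: group "Multiplicative_Group.mult_of (R Quot two_ideal)"
    by (rule residue.field_mult_group)
  have "order (Multiplicative_Group.mult_of (R Quot two_ideal)) = 2 ^ n - 1"
    using residue.order_mult_of[OF finite_residue] card_residue by (simp add: order_def)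
  then have "c [^]\<^bsub>R Quot two_ideal\<^esub> (2 ^ n - 1 :: nat) = \<one>\<^bsub>R Quot two_ideal\<^esub>"
    using M.pow_order_eq_1[of c] False assms by (simp add: Multiplicative_Group.nat_pow_mult_of)
  then have "c [^]\<^bsub>R Quot two_ideal\<^esub> Suc (2 ^ n - 1) = c"
    using assms by (simp only: residue.nat_pow_Suc residue.l_one)
  then show ?thesis
    by simp
qed

section \<open>Squares and \<open>q\<close>-th powers modulo \<open>2R\<close>\<close>

lemma dbl_pow_q:
  assumes "x \<in> carrier R" shows "dbl (x [^] (2 ^ n :: nat)) = dbl x"
  using residue_pow_card[of "two_ideal +> x"] assms
  by (simp add: coset_nat_pow coset_eq_iff residue_carrier)

text \<open>In the square of \<open>y + 2r\<close> all terms other than the square of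
  \<open>y\<close> are multiples of 4.\<close>

lemma sq_cong:
  assumes "x \<in> carrier R" "y \<in> carrier R" "dbl x = dbl y"
  shows "x \<otimes> x = y \<otimes> y"
proof -
  obtain r where r: "r \<in> carrier R" "x = y \<oplus> dbl r"
    using assms by (rule dbl_eq_obtain)
  have "x \<otimes> x = y \<otimes> y \<oplus> (dbl (y \<otimes> r) \<oplus> dbl (y \<otimes> r)) \<oplus> dbl (dbl (r \<otimes> r))"
    using assms(2) r(1)
    by (simp add: r(2) l_distr r_distr dbl_mult_l dbl_mult_r dbl_add m_comm[of r y] add.m_assoc)
  also have "dbl (y \<otimes> r) \<oplus> dbl (y \<otimes> r) = dbl (dbl (y \<otimes> r))"
    by (simp add: dbl_def)
  finally show ?thesis
    using assms(2) r(1) by simp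
qed

text \<open>Splitting off one squaring, possible because \<open>n > 0\<close>, makes
  \<open>sq_cong\<close> applicable to \<open>q\<close>-th powers.\<close>

lemma pow_q_eq_sq_pow:
  assumes "x \<in> carrier R" shows "x [^] (2 ^ n :: nat) = (x \<otimes> x) [^] (2 ^ (n - 1) :: nat)"
proof -
  have "(x [^] (2::nat)) [^] (2 ^ (n - 1) :: nat) = x [^] (2 ^ n :: nat)"
    using assms n_pos by (simp add: nat_pow_pow flip: power_Suc)
  then show ?thesis
    using assms by (simp add: numeral_2_eq_2)
qed

lemma pow_q_cong:
  "\<lbrakk>x \<in> carrier R; y \<in> carrier R; dbl x = dbl y\<rbrakk> \<Longrightarrow> x [^] (2 ^ n :: nat) = y [^] (2 ^ n :: nat)"
  using sq_cong[of x y] by (simp add: pow_q_eq_sq_pow)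

lemma sq_eq_iff:
  assumes "x \<in> carrier R" "y \<in> carrier R"
  shows "x \<otimes> x = y \<otimes> y \<longleftrightarrow> dbl x = dbl y"
proof
  assume "x \<otimes> x = y \<otimes> y"
  \<comment> \<open>Equal squares give equal \<open>q\<close>-th powers, and each of these is
    congruent to its base.\<close>
  then have "x [^] (2 ^ n :: nat) = y [^] (2 ^ n :: nat)"
    using assms by (simp add: pow_q_eq_sq_pow)
  then show "dbl x = dbl y"
    using assms dbl_pow_q[of x] dbl_pow_q[of y] by simp
qed (rule sq_cong[OF assms])

section \<open>The Teichmueller set as a system of representatives\<close>

lemma teich_closed: "x \<in> teich \<Longrightarrow> x \<in> carrier R"
  by (simp add: teich_def)

lemma teichD: "x \<in> teich \<Longrightarrow> x [^] (2 ^ n :: nat) = x"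
  by (simp add: teich_def)

text \<open>\<open>x ^ q\<close> is congruent to \<open>x\<close>, and \<open>q\<close>-th powers
  depend only on the class, so a second \<open>q\<close>-th power changes nothing.\<close>

lemma pow_q_teich: "x \<in> carrier R \<Longrightarrow> x [^] (2 ^ n :: nat) \<in> teich"
  using pow_q_cong[of "x [^] (2 ^ n :: nat)" x] by (simp add: teich_def dbl_pow_q)

lemma zero_teich: "\<zero> \<in> teich"
  by (simp add: teich_def nat_pow_zero)

lemma one_teich: "\<one> \<in> teich"
  by (simp add: teich_def)

lemma mult_teich: "\<lbrakk>x \<in> teich; y \<in> teich\<rbrakk> \<Longrightarrow> x \<otimes> y \<in> teich"
  by (simp add: teich_def pow_mult_distrib m_comm)

lemma teich_eqI: "\<lbrakk>x \<in> teich; y \<in> teich; dbl x = dbl y\<rbrakk> \<Longrightarrow> x = y"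
  using pow_q_cong[of x y] by (simp add: teich_closed teichD)

lemma sq_teich:
  assumes "x \<in> carrier R" shows "x \<otimes> x \<in> teich"
proof -
  let ?t = "x [^] (2 ^ n :: nat)"
  \<comment> \<open>Passing to the representative \<open>?t\<close> of the class of \<open>x\<close>
    leaves the square unchanged.\<close>
  have "x \<otimes> x = ?t \<otimes> ?t"
    using assms by (intro sq_cong) (simp_all add: dbl_pow_q)
  then show ?thesis
    using assms by (simp add: mult_teich pow_q_teich)
qed

lemma finite_teich: "finite teich"
  using finite_carrier by (simp add: teich_def)

text \<open>Doubles label the residue classes, so \<open>teich\<close> is a transversal of
  \<open>two_ideal\<close>; the \<open>q\<close>-th power of any member represents its
  class.\<close>

lemma bij_betw_dbl_teich: "bij_betw dbl teich two_ideal"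
proof (rule bij_betw_imageI)
  show "inj_on dbl teich"
    by (auto intro: inj_onI teich_eqI)
  show "dbl ` teich = two_ideal"
  proof (intro equalityI subsetI)
    fix m assume "m \<in> two_ideal"
    then obtain r where "r \<in> carrier R" "m = dbl r"
      by (auto simp: two_ideal_eq)
    then show "m \<in> dbl ` teich"
      using dbl_pow_q pow_q_teich by (intro image_eqI[of _ _ "r [^] (2 ^ n :: nat)"]) simp_all
  qed (auto simp: two_ideal_eq teich_closed)
qed

lemma card_teich: "card teich = 2 ^ n"
  using bij_betw_same_card[OF bij_betw_dbl_teich] card_two_ideal by simp

section \<open>The Teichmueller units as a cyclic group\<close>

lemma teich_mem_two_ideal_iff: "x \<in> teich \<Longrightarrow> x \<in> two_ideal \<longleftrightarrow> x = \<zero>"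
  using dbl_eq_zero_iff[of x] teich_eqI[of x \<zero>] zero_teich teich_closed by auto

lemma teich_Units: "x \<in> teich - {\<zero>} \<Longrightarrow> x \<in> Units R"
  by (simp add: Units_iff teich_closed teich_mem_two_ideal_iff)

lemma subgroup_teich: "subgroup (teich - {\<zero>}) (units_of R)"
proof -
  interpret U: group "units_of R"
    by (rule units_group)
  have prod: "x \<otimes> y \<in> teich - {\<zero>}" if "x \<in> teich - {\<zero>}" "y \<in> teich - {\<zero>}" for x y
  proof -
    have "x \<otimes> y \<in> Units R"
      using that teich_Units by blast
    then have "x \<otimes> y \<notin> two_ideal"
      using that Units_iff by blast
    then show ?thesis
      using that mult_teich teich_mem_two_ideal_iff by blast
  qed
  have inverse: "inv\<^bsub>units_of R\<^esub> x \<in> teich - {\<zero>}" if x: "x \<in> teich - {\<zero>}" for x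
  proof -
    \<comment> \<open>The \<open>q\<close>-th power moves the inverse into \<open>teich\<close>; it
      still inverts \<open>x\<close> because \<open>x ^ q = x\<close>.\<close>
    define v where "v = (inv x) [^] (2 ^ n :: nat)"
    have xU: "x \<in> Units R"
      using x by (rule teich_Units)
    have v: "v \<in> Units R" "v \<in> teich"
      using xU by (simp_all add: v_def Units_pow_closed pow_q_teich)
    have "v \<otimes> x [^] (2 ^ n :: nat) = (inv x \<otimes> x) [^] (2 ^ n :: nat)"
      unfolding v_def
      by (rule pow_mult_distrib[symmetric]) (use xU in \<open>simp_all add: m_comm Units_closed\<close>)
    then have "v \<otimes> x = \<one>"
      using x xU by (simp add: teichD)
    then have "inv\<^bsub>units_of R\<^esub> x = v"
      using xU v by (intro U.inv_equality) (simp_all add: units_of_carrier units_of_mult units_of_one)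
    moreover have "v \<noteq> \<zero>"
      using v Units_iff[of \<zero>] teich_mem_two_ideal_iff[of \<zero>] zero_teich by auto
    ultimately show ?thesis
      using v by simp
  qed
  show ?thesis
  proof (rule U.subgroupI)
    show "teich - {\<zero>} \<noteq> {}"
      using one_teich one_neq_zero by auto
  qed (use prod inverse teich_Units in \<open>auto simp: units_of_carrier units_of_mult\<close>)
qed

text \<open>A generator of the multiplicative group of the residue field is represented by some
  \<open>g\<close> in \<open>teich\<close>, whose powers meet every nonzero class.\<close>

lemma cyclic_teich: "cyclic_group ((units_of R)\<lparr>carrier := teich - {\<zero>}\<rparr>)"
proof -
  interpret U: group "units_of R"
    by (rule units_group)
  let ?T = "(units_of R)\<lparr>carrier := teich - {\<zero>}\<rparr>"
  interpret T: group ?T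
    by (rule U.subgroup_imp_group[OF subgroup_teich])
  have pow: "x [^]\<^bsub>?T\<^esub> (k::nat) = x [^] k" for x k
    by (simp add: nat_pow_def units_of_def)
  obtain c where c: "c \<in> carrier (Multiplicative_Group.mult_of (R Quot two_ideal))"
    "carrier (Multiplicative_Group.mult_of (R Quot two_ideal)) = {c [^]\<^bsub>R Quot two_ideal\<^esub> i | i::nat. i \<in> UNIV}"
    using residue.finite_field_mult_group_has_gen[OF finite_residue] by (auto simp: Multiplicative_Group.nat_pow_mult_of)
  then obtain a where a: "a \<in> carrier R" "c = two_ideal +> a"
    by (auto simp: residue_carrier)
  define g where "g = a [^] (2 ^ n :: nat)"
  have zero: "\<zero>\<^bsub>R Quot two_ideal\<^esub> = two_ideal +> \<zero>"
    using ideal.rcos_ring_hom_ring[OF ideal_two_ideal]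
    by (metis ring_hom_ring.homh ring_hom_zero residue.ring_axioms ring_axioms)
  have "dbl a \<noteq> dbl \<zero>"
    using c(1) a by (simp add: zero coset_eq_iff)
  then have "dbl g \<noteq> dbl \<zero>"
    using a by (simp add: g_def dbl_pow_q)
  then have g: "g \<in> teich - {\<zero>}"
    using a pow_q_teich by (auto simp: g_def)
  have "x \<in> range (\<lambda>k::int. g [^]\<^bsub>?T\<^esub> k)" if x: "x \<in> teich - {\<zero>}" for x
  proof -
    have "two_ideal +> x \<in> carrier (Multiplicative_Group.mult_of (R Quot two_ideal))"
      using x teich_eqI[of x \<zero>] zero_teich
      by (auto simp: residue_carrier zero coset_eq_iff teich_closed)
    then obtain i :: nat where "two_ideal +> x = c [^]\<^bsub>R Quot two_ideal\<^esub> i"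
      using c(2) by auto
    then have "dbl x = dbl (a [^] i)"
      using a x by (simp add: coset_nat_pow coset_eq_iff teich_closed)
    \<comment> \<open>Taking \<open>q\<close>-th powers turns the congruence into an equality:
      \<open>x\<close> is fixed and the power of \<open>a\<close> becomes one of
      \<open>g\<close>.\<close>
    then have "x = (a [^] i) [^] (2 ^ n :: nat)"
      using pow_q_cong[of x "a [^] i"] x a by (simp add: teich_closed teichD)
    also have "\<dots> = g [^] i"
      using a by (simp add: g_def nat_pow_pow mult.commute)
    finally have "x = g [^]\<^bsub>?T\<^esub> int i"
      by (simp add: int_pow_int pow)
    then show ?thesis
      by blast
  qed
  then have "carrier ?T = range (\<lambda>k::int. g [^]\<^bsub>?T\<^esub> k)"
    using g T.int_pow_closed[of g] by auto
  then show ?thesis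
    using g by (auto simp: T.cyclic_group)
qed

lemma card_teich_units: "card (teich - {\<zero>}) = 2 ^ n - 1"
  using zero_teich finite_teich by (simp add: card_Diff_singleton card_teich)

text \<open>In a subgroup of order \<open>2 ^ n - 1\<close> every \<open>x\<close> satisfies
  \<open>x ^ q = x\<close>, so the subgroup lies in \<open>teich\<close>; comparing cardinalities
  gives uniqueness.\<close>

lemma teichmueller_units_eq: "teichmueller_units R n = teich - {\<zero>}"
  unfolding teichmueller_units_def
proof (rule the_equality)
  fix T assume T: "subgroup T (units_of R) \<and> cyclic_group ((units_of R)\<lparr>carrier := T\<rparr>) \<and>
    card T = 2 ^ n - 1"
  interpret U: group "units_of R"
    by (rule units_group)
  interpret T: group "(units_of R)\<lparr>carrier := T\<rparr>"
    by (rule U.subgroup_imp_group) (use T in simp)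
  have "T \<subseteq> teich - {\<zero>}"
  proof
    fix x assume x: "x \<in> T"
    then have xU: "x \<in> Units R"
      using T subgroup.subset[of T "units_of R"] by (auto simp: units_of_carrier)
    have "x [^]\<^bsub>(units_of R)\<lparr>carrier := T\<rparr>\<^esub> (2 ^ n - 1 :: nat) = \<one>"
      using T.pow_order_eq_1[of x] x T by (simp add: order_def units_of_one)
    then have "x [^] (2 ^ n - 1 :: nat) = \<one>"
      by (simp add: nat_pow_def units_of_def)
    then have "x [^] Suc (2 ^ n - 1) = x"
      using xU by (simp only: nat_pow_Suc l_one Units_closed)
    moreover have "x \<noteq> \<zero>"
      using xU Units_iff[of x] dbl_eq_zero_iff[of \<zero>] by auto
    ultimately show "x \<in> teich - {\<zero>}"
      using xU by (simp add: teich_def Units_closed)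
  qed
  then show "T = teich - {\<zero>}"
    using T finite_teich by (intro card_subset_eq) (auto simp: card_teich_units)
qed (use subgroup_teich cyclic_teich card_teich_units in blast)

lemma teichmueller_set_eq: "teichmueller_set R n = teich"
  using zero_teich by (auto simp: teichmueller_set_def teichmueller_units_eq)

section \<open>Square roots and the field addition\<close>

abbreviation tsqrt :: "'a \<Rightarrow> 'a" where
  "tsqrt \<equiv> teichmueller_sqrt R n"

text \<open>Elements of \<open>teich\<close> with equal squares are congruent, hence equal, so the
  definite description is determined.\<close>

lemma tsqrt_sq:
  assumes "w \<in> teich" shows "tsqrt (w \<otimes> w) = w"
  unfolding teichmueller_sqrt_def teichmueller_set_eq
proof (rule the_equality)
  fix v assume "v \<in> teich \<and> v \<otimes> v = w \<otimes> w"
  then show "v = w"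
    using assms sq_eq_iff[of v w] by (auto intro!: teich_eqI[of v w] simp: teich_closed)
qed (use assms in simp)

lemma teich_obtain_sqrt:
  assumes "z \<in> teich" obtains w where "w \<in> teich" "z = w \<otimes> w"
proof
  \<comment> \<open>The square of \<open>?r\<close> is \<open>z ^ q\<close>, which equals
    \<open>z\<close>.\<close>
  let ?r = "z [^] (2 ^ (n - 1) :: nat)"
  have z: "z \<in> carrier R"
    using assms by (rule teich_closed)
  have "?r [^] (2 ^ n :: nat) = (z [^] (2 ^ n :: nat)) [^] (2 ^ (n - 1) :: nat)"
    using z by (simp add: nat_pow_pow mult.commute)
  then show "?r \<in> teich"
    using z assms by (simp add: teich_def)
  show "z = ?r \<otimes> ?r"
    using z pow_q_eq_sq_pow[OF z] teichD[OF assms] by (simp add: pow_mult_distrib m_comm)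
qed

lemma tsqrt_teich: "z \<in> teich \<Longrightarrow> tsqrt z \<in> teich"
  by (erule teich_obtain_sqrt) (simp add: tsqrt_sq)

lemma sq_tsqrt: "z \<in> teich \<Longrightarrow> tsqrt z \<otimes> tsqrt z = z"
  by (erule teich_obtain_sqrt) (simp add: tsqrt_sq)

text \<open>Lets values of the planar map be quantified as squares of \<open>b\<close>, the form in
  which differences \<open>\<epsilon> + 2b\<close> produce them.\<close>

lemma ball_teich_sq: "(\<forall>z \<in> teich. P z) \<longleftrightarrow> (\<forall>w \<in> teich. P (w \<otimes> w))"
proof
  assume P: "\<forall>w \<in> teich. P (w \<otimes> w)"
  show "\<forall>z \<in> teich. P z"
  proof
    fix z assume "z \<in> teich"
    then obtain w where "w \<in> teich" "z = w \<otimes> w"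
      by (rule teich_obtain_sqrt)
    then show "P z"
      using P by simp
  qed
qed (simp add: mult_teich)

definition tadd :: "'a \<Rightarrow> 'a \<Rightarrow> 'a" where
  "tadd x y = x \<oplus> y \<oplus> dbl (tsqrt (x \<otimes> y))"

lemma tadd_field:
  "\<lbrakk>x \<in> teich; y \<in> teich\<rbrakk> \<Longrightarrow> x \<oplus>\<^bsub>teichmueller_field R n\<^esub> y = tadd x y"
  by (simp add: teichmueller_field_def tadd_def add_pow_two tsqrt_teich mult_teich teich_closed)

text \<open>The correction term \<open>2 * sqrt (x * y)\<close> completes \<open>x + y\<close> to the square of
  \<open>sqrt x + sqrt y\<close>, and squares lie in the Teichmueller set.\<close>

lemma tadd_teich:
  assumes "x \<in> teich" "y \<in> teich" shows "tadd x y \<in> teich"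
proof -
  obtain a where ab1: "a \<in> teich" "x = a \<otimes> a"
    using assms(1) by (rule teich_obtain_sqrt)
  obtain b where ab2: "b \<in> teich" "y = b \<otimes> b"
    using assms(2) by (rule teich_obtain_sqrt)
  note ab = ab1 ab2
  then have c: "a \<in> carrier R" "b \<in> carrier R"
    by (auto simp: teich_closed)
  have "x \<otimes> y = (a \<otimes> b) \<otimes> (a \<otimes> b)"
    using ab c by (simp add: m_ac)
  then have "tsqrt (x \<otimes> y) = a \<otimes> b"
    using ab by (simp add: tsqrt_sq mult_teich)
  then have "tadd x y = (a \<oplus> b) \<otimes> (a \<oplus> b)"
    using ab c by (simp add: tadd_def dbl_def l_distr r_distr m_comm[of b a] add.m_ac)
  then show ?thesis
    using c by (simp add: sq_teich)
qed

text \<open>The correction term in \<open>tadd\<close> is itself a double, so doubling kills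
  it.\<close>

lemma dbl_tadd:
  "\<lbrakk>x \<in> teich; y \<in> teich\<rbrakk> \<Longrightarrow> dbl (tadd x y) = dbl x \<oplus> dbl y"
  by (simp add: tadd_def dbl_add teich_closed tsqrt_teich mult_teich)

text \<open>The cross term is a double and vanishes under \<open>dbl\<close>: the Frobenius map is
  additive modulo \<open>2R\<close>.\<close>

lemma dbl_sq_add:
  "\<lbrakk>x \<in> carrier R; y \<in> carrier R\<rbrakk> \<Longrightarrow> dbl ((x \<oplus> y) \<otimes> (x \<oplus> y)) = dbl (x \<otimes> x) \<oplus> dbl (y \<otimes> y)"
proof -
  assume xy: "x \<in> carrier R" "y \<in> carrier R"
  then have "(x \<oplus> y) \<otimes> (x \<oplus> y) = x \<otimes> x \<oplus> y \<otimes> y \<oplus> dbl (x \<otimes> y)"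
    by (simp add: dbl_def l_distr r_distr m_comm[of y x] add.m_ac)
  then show ?thesis
    using xy by (simp add: dbl_add)
qed

section \<open>Coordinates \<open>\<epsilon> + 2b\<close> outside \<open>2R\<close>\<close>

lemma not_two_ideal_obtain:
  assumes "g \<in> carrier R - two_ideal"
  obtains \<epsilon> b where "\<epsilon> \<in> teich - {\<zero>}" "b \<in> teich" "g = \<epsilon> \<oplus> dbl b"
proof -
  \<comment> \<open>The representative of the class of \<open>g\<close>. The remainder is a double
    \<open>dbl r\<close>, where \<open>r\<close> may be replaced by its own representative.\<close>
  let ?\<epsilon> = "g [^] (2 ^ n :: nat)"
  have g: "g \<in> carrier R" "dbl g = dbl ?\<epsilon>" "dbl g \<noteq> \<zero>"
    using assms by (auto simp: dbl_pow_q dbl_eq_zero_iff)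
  obtain r where r: "r \<in> carrier R" "g = ?\<epsilon> \<oplus> dbl r"
    by (rule dbl_eq_obtain[OF g(1) nat_pow_closed[OF g(1)] g(2)])
  have "?\<epsilon> \<noteq> \<zero>"
    using g(2,3) by (intro notI) (simp only: dbl_zero)
  then show thesis
    using that[of ?\<epsilon> "r [^] (2 ^ n :: nat)"] g(1) r by (simp add: dbl_pow_q pow_q_teich)
qed

lemma not_two_ideal_sum:
  assumes "\<epsilon> \<in> teich - {\<zero>}" "b \<in> teich" shows "\<epsilon> \<oplus> dbl b \<in> carrier R - two_ideal"
proof -
  have "dbl (\<epsilon> \<oplus> dbl b) = dbl \<epsilon>"
    using assms by (simp add: dbl_add teich_closed)
  then show ?thesis
    using assms dbl_eq_zero_iff[of \<epsilon>] dbl_eq_zero_iff[of "\<epsilon> \<oplus> dbl b"] teich_mem_two_ideal_iff[of \<epsilon>]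
    by (auto simp: teich_closed)
qed

section \<open>Differences of points of \<open>D\<close> and the planar map\<close>

context
  fixes f :: "'a \<Rightarrow> 'a"
  assumes f: "f \<in> teich \<rightarrow> teich"
begin

text \<open>The point of \<open>D\<close> over \<open>x\<close>.\<close>

definition lift_point :: "'a \<Rightarrow> 'a" where
  "lift_point x = x \<oplus> dbl (tsqrt (f x))"

definition planar_map :: "'a \<Rightarrow> 'a \<Rightarrow> 'a" where
  "planar_map \<epsilon> x = tadd (tadd (f (tadd x \<epsilon>)) (f x)) (\<epsilon> \<otimes> x)"

lemma f_teich: "x \<in> teich \<Longrightarrow> f x \<in> teich"
  using f by auto

lemma lift_point_closed: "x \<in> teich \<Longrightarrow> lift_point x \<in> carrier R"
  by (simp add: lift_point_def f_teich tsqrt_teich teich_closed)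

lemma dbl_lift_point: "x \<in> teich \<Longrightarrow> dbl (lift_point x) = dbl x"
  by (simp add: lift_point_def dbl_add f_teich tsqrt_teich teich_closed)

text \<open>The parameter is recovered from the class of the point modulo \<open>2R\<close>.\<close>

lemma inj_on_lift_point: "inj_on lift_point teich"
proof (rule inj_onI)
  fix x y assume "x \<in> teich" "y \<in> teich" "lift_point x = lift_point y"
  then show "x = y"
    using dbl_lift_point[of x] dbl_lift_point[of y] by (auto intro!: teich_eqI[of x y])
qed

lemma planar_map_teich: "\<lbrakk>\<epsilon> \<in> teich; x \<in> teich\<rbrakk> \<Longrightarrow> planar_map \<epsilon> x \<in> teich"
  by (simp add: planar_map_def tadd_teich f_teich mult_teich)

lemma planar_field_iff:
  "planar (teichmueller_field R n) f \<longleftrightarrow>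
    (\<forall>\<epsilon> \<in> teich - {\<zero>}. bij_betw (planar_map \<epsilon>) teich teich)"
proof -
  let ?K = "teichmueller_field R n"
  have car: "carrier ?K = teich" "\<zero>\<^bsub>?K\<^esub> = \<zero>" "x \<otimes>\<^bsub>?K\<^esub> y = x \<otimes> y" for x y
    by (simp_all add: teichmueller_field_def teichmueller_set_eq)
  have "bij_betw (\<lambda>x. f (x \<oplus>\<^bsub>?K\<^esub> \<epsilon>) \<oplus>\<^bsub>?K\<^esub> f x \<oplus>\<^bsub>?K\<^esub> \<epsilon> \<otimes>\<^bsub>?K\<^esub> x) teich teich =
      bij_betw (planar_map \<epsilon>) teich teich" if "\<epsilon> \<in> teich" for \<epsilon>
    using that
    by (intro bij_betw_cong) (simp add: planar_map_def car tadd_field tadd_teich f_teich mult_teich)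
  then show ?thesis
    by (simp add: planar_def car)
qed

lemma dbl_lift_diff:
  "\<lbrakk>x \<in> teich; y \<in> teich\<rbrakk> \<Longrightarrow> dbl (lift_point x \<ominus> lift_point y) = dbl x \<oplus> dbl y"
  by (simp add: a_minus_def dbl_add dbl_minus dbl_lift_point lift_point_closed minus_dbl teich_closed)

text \<open>The terms in \<open>y\<close> cancel, and the root of \<open>f y\<close> enters with a
  plus sign because doubles are their own negatives. The third root is the correction term of
  \<open>tadd y \<epsilon>\<close>.\<close>

lemma lift_diff_tadd:
  assumes "\<epsilon> \<in> teich" "y \<in> teich"
  shows "lift_point (tadd y \<epsilon>) \<ominus> lift_point y =
    \<epsilon> \<oplus> dbl (tsqrt (f (tadd y \<epsilon>)) \<oplus> tsqrt (f y) \<oplus> tsqrt (y \<otimes> \<epsilon>))"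
proof -
  define u v w where "u = tsqrt (f (tadd y \<epsilon>))" and "v = tsqrt (f y)" and "w = tsqrt (y \<otimes> \<epsilon>)"
  have c: "u \<in> carrier R" "v \<in> carrier R" "w \<in> carrier R" "y \<in> carrier R" "\<epsilon> \<in> carrier R"
    using assms by (auto simp: u_def v_def w_def
        intro!: teich_closed tsqrt_teich mult_teich tadd_teich f_teich)
  have "lift_point (tadd y \<epsilon>) \<ominus> lift_point y = (y \<oplus> \<epsilon> \<oplus> dbl w \<oplus> dbl u) \<ominus> (y \<oplus> dbl v)"
    by (simp add: lift_point_def tadd_def u_def v_def w_def)
  also have "\<dots> = \<epsilon> \<oplus> dbl (u \<oplus> v \<oplus> w)"
    using c by (simp add: a_minus_def minus_add minus_dbl dbl_add add.m_ac r_neg1 r_neg2)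
  finally show ?thesis
    by (simp add: u_def v_def w_def)
qed

text \<open>Both sides lie in \<open>teich\<close>, so congruence suffices, and modulo
  \<open>2R\<close> squaring distributes over the three roots.\<close>

lemma planar_map_eq_sq:
  assumes "\<epsilon> \<in> teich" "y \<in> teich"
  defines "s \<equiv> tsqrt (f (tadd y \<epsilon>)) \<oplus> tsqrt (f y) \<oplus> tsqrt (y \<otimes> \<epsilon>)"
  shows "planar_map \<epsilon> y = s \<otimes> s"
proof (rule teich_eqI)
  have t: "f (tadd y \<epsilon>) \<in> teich" "f y \<in> teich" "y \<otimes> \<epsilon> \<in> teich"
    using assms(1,2) by (auto intro: f_teich tadd_teich mult_teich)
  have c: "tsqrt (f (tadd y \<epsilon>)) \<in> carrier R" "tsqrt (f y) \<in> carrier R" "tsqrt (y \<otimes> \<epsilon>) \<in> carrier R"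
    using t by (auto intro: teich_closed tsqrt_teich)
  show "planar_map \<epsilon> y \<in> teich"
    using assms(1,2) by (rule planar_map_teich)
  show "s \<otimes> s \<in> teich"
    using c by (simp add: s_def sq_teich)
  have "dbl (s \<otimes> s) = dbl (f (tadd y \<epsilon>)) \<oplus> dbl (f y) \<oplus> dbl (y \<otimes> \<epsilon>)"
    using c t by (simp add: s_def dbl_sq_add sq_tsqrt)
  moreover have "y \<otimes> \<epsilon> = \<epsilon> \<otimes> y"
    using assms(1,2) by (simp add: m_comm teich_closed)
  ultimately show "dbl (planar_map \<epsilon> y) = dbl (s \<otimes> s)"
    using t by (simp add: planar_map_def dbl_tadd tadd_teich)
qed

lemma lift_diff_eq_iff:
  assumes "\<epsilon> \<in> teich" "b \<in> teich" "x \<in> teich" "y \<in> teich"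
  shows "lift_point x \<ominus> lift_point y = \<epsilon> \<oplus> dbl b \<longleftrightarrow>
    x = tadd y \<epsilon> \<and> planar_map \<epsilon> y = b \<otimes> b"
proof -
  have c: "x \<in> carrier R" "y \<in> carrier R" "\<epsilon> \<in> carrier R" "b \<in> carrier R"
    using assms by (auto simp: teich_closed)
  define s where "s = tsqrt (f (tadd y \<epsilon>)) \<oplus> tsqrt (f y) \<oplus> tsqrt (y \<otimes> \<epsilon>)"
  have s: "s \<in> carrier R"
    using assms unfolding s_def
    by (intro add.m_closed teich_closed tsqrt_teich mult_teich tadd_teich f_teich)
  have x: "x = tadd y \<epsilon>" if "lift_point x \<ominus> lift_point y = \<epsilon> \<oplus> dbl b"
  proof (rule teich_eqI)
    \<comment> \<open>Signs vanish modulo \<open>2R\<close>, so adding \<open>y\<close> once more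
      solves for the class of \<open>x\<close>.\<close>
    have "dbl x \<oplus> dbl y = dbl \<epsilon>"
      using dbl_lift_diff[of x y] assms c by (simp add: that dbl_add)
    then have "dbl y \<oplus> (dbl x \<oplus> dbl y) = dbl y \<oplus> dbl \<epsilon>"
      by simp
    then show "dbl x = dbl (tadd y \<epsilon>)"
      using assms c r_neg1[of "dbl y" "dbl x"]
      by (simp add: dbl_tadd minus_dbl add.m_comm[of "dbl x"])
  qed (use assms in \<open>auto intro: tadd_teich\<close>)
  \<comment> \<open>Cancelling \<open>\<epsilon>\<close> leaves equal doubles, which is the same as
    equal squares.\<close>
  have "\<epsilon> \<oplus> dbl s = \<epsilon> \<oplus> dbl b \<longleftrightarrow> planar_map \<epsilon> y = b \<otimes> b"
    using s c assms planar_map_eq_sq[of \<epsilon> y] by (simp add: sq_eq_iff s_def)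
  then show ?thesis
    using x lift_diff_tadd[of \<epsilon> y] assms by (auto simp: s_def)
qed

text \<open>A pair with this difference is determined by the parameter \<open>y\<close> of its
  second entry, since the first parameter must be \<open>tadd y \<epsilon>\<close>.\<close>

lemma card_lift_diff:
  assumes "\<epsilon> \<in> teich" "b \<in> teich"
  shows "card {(x, y) \<in> lift_point ` teich \<times> lift_point ` teich. x \<ominus> y = \<epsilon> \<oplus> dbl b} =
    card {y \<in> teich. planar_map \<epsilon> y = b \<otimes> b}"
proof -
  have "bij_betw (\<lambda>y. (lift_point (tadd y \<epsilon>), lift_point y))
     {y \<in> teich. planar_map \<epsilon> y = b \<otimes> b}
     {(x, y) \<in> lift_point ` teich \<times> lift_point ` teich. x \<ominus> y = \<epsilon> \<oplus> dbl b}"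
    using assms inj_on_lift_point
    by (intro bij_betw_imageI)
       (auto simp: inj_on_def lift_diff_eq_iff tadd_teich)
  then show ?thesis
    by (simp add: bij_betw_same_card)
qed

text \<open>Points that differ by an element of \<open>two_ideal\<close> have the same class, hence
  the same parameter, and their difference is 0.\<close>

lemma card_lift_diff_two_ideal:
  assumes "g \<in> two_ideal - {\<zero>}"
  shows "card {(x, y) \<in> lift_point ` teich \<times> lift_point ` teich. x \<ominus> y = g} = 0"
proof -
  have "x = y" if "x \<in> teich" "y \<in> teich" "lift_point x \<ominus> lift_point y \<in> two_ideal" for x y
    using that dbl_eq_iff[of "lift_point x" "lift_point y"]
    by (auto intro: teich_eqI simp: dbl_lift_point lift_point_closed)
  then have "{(x, y) \<in> lift_point ` teich \<times> lift_point ` teich. x \<ominus> y = g} = {}"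
    using assms by (force simp: lift_point_closed a_minus_def r_neg)
  then show ?thesis
    by (simp only: card.empty)
qed

lemma relative_difference_set_iff_planar:
  "relative_difference_set (add_monoid R) two_ideal (lift_point ` teich) (2 ^ n, 2 ^ n, 2 ^ n, 1)
    \<longleftrightarrow> planar (teichmueller_field R n) f"
proof -
  let ?cnt = "\<lambda>g. card {(x, y) \<in> lift_point ` teich \<times> lift_point ` teich. x \<ominus> y = g}"
  have diff: "x \<oplus> inv\<^bsub>add_monoid R\<^esub> y = x \<ominus> y" for x y
    by (simp add: a_minus_def a_inv_def)
  have sub: "subgroup two_ideal (add_monoid R)"
    by (rule additive_subgroup.a_subgroup[OF ideal.axioms(1)[OF ideal_two_ideal]])
  have four_pow: "(4::nat) ^ n = 2 ^ n * 2 ^ n"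
    by (simp flip: power_mult_distrib)
  have "order (add_monoid R) div card two_ideal = 2 ^ n"
    using card_carrier by (simp add: order_def card_two_ideal four_pow)
  \<comment> \<open>The subgroup property, the three cardinalities and the zero counts inside
    \<open>two_ideal\<close> hold for every such \<open>f\<close>; only the count outside remains as
    a condition.\<close>
  then have "relative_difference_set (add_monoid R) two_ideal (lift_point ` teich)
      (2 ^ n, 2 ^ n, 2 ^ n, 1) \<longleftrightarrow> (\<forall>g \<in> carrier R - two_ideal. ?cnt g = 1)"
    using sub card_lift_diff_two_ideal inj_on_lift_point lift_point_closed
    by (auto simp: relative_difference_set_def diff finite_carrier card_two_ideal card_teich
        card_image add.is_group simp del: card_eq_0_iff)
  \<comment> \<open>The elements outside \<open>two_ideal\<close> are exactly the sums
    \<open>\<epsilon> + 2b\<close>, so the count can be taken in these coordinates.\<close>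
  also have "\<dots> \<longleftrightarrow> (\<forall>\<epsilon> \<in> teich - {\<zero>}. \<forall>b \<in> teich. card {y \<in> teich. planar_map \<epsilon> y = b \<otimes> b} = 1)"
    (is "?L \<longleftrightarrow> ?R")
  proof
    assume L: ?L
    show ?R
    proof (intro ballI)
      fix \<epsilon> b assume "\<epsilon> \<in> teich - {\<zero>}" "b \<in> teich"
      then show "card {y \<in> teich. planar_map \<epsilon> y = b \<otimes> b} = 1"
        using L not_two_ideal_sum[of \<epsilon> b] card_lift_diff[of \<epsilon> b] by simp
    qed
  next
    assume R: ?R
    show ?L
    proof
      fix g assume "g \<in> carrier R - two_ideal"
      then obtain \<epsilon> b where "\<epsilon> \<in> teich - {\<zero>}" "b \<in> teich" "g = \<epsilon> \<oplus> dbl b"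
        by (rule not_two_ideal_obtain)
      then show "?cnt g = 1"
        using R card_lift_diff[of \<epsilon> b] by simp
    qed
  qed
  also have "\<dots> \<longleftrightarrow> (\<forall>\<epsilon> \<in> teich - {\<zero>}. \<forall>z \<in> teich. card {y \<in> teich. planar_map \<epsilon> y = z} = 1)"
    by (simp only: ball_teich_sq[where P = "\<lambda>z. card {y \<in> teich. planar_map _ y = z} = 1"])
  also have "\<dots> \<longleftrightarrow> planar (teichmueller_field R n) f"
    unfolding planar_field_iff
    by (intro ball_cong refl bij_betw_iff_card_fibres[symmetric]) (auto simp: planar_map_teich)
  finally show ?thesis .
qed

end

end

theorem theorem2p1:
  fixes R :: "('a, 'b) ring_scheme" and n :: nat and f :: "'a \<Rightarrow> 'a"
  assumes "galois_ring R"
    and "ring_char R = 4"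
    and "card (carrier R) = 4 ^ n"
    and "f \<in> teichmueller_set R n \<rightarrow> teichmueller_set R n"
  shows "relative_difference_set (add_monoid R) (PIdl\<^bsub>R\<^esub> (add_pow R (2::nat) \<one>\<^bsub>R\<^esub>))
           ((\<lambda>x. x \<oplus>\<^bsub>R\<^esub> add_pow R (2::nat) (teichmueller_sqrt R n (f x))) ` teichmueller_set R n)
           (2 ^ n, 2 ^ n, 2 ^ n, 1)
         \<longleftrightarrow> planar (teichmueller_field R n) f"
proof -
  interpret cring R
    using assms(1) by (simp add: galois_ring_def)
  interpret galois_ring_char4 R n
    by unfold_locales (fact assms)+
  have f: "f \<in> teich \<rightarrow> teich"
    using assms(4) by (simp add: teichmueller_set_eq)
  \<comment> \<open>Since \<open>f\<close> maps \<open>teich\<close> to itself, the roots lie in the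
    carrier, where \<open>add_pow R 2\<close> is \<open>dbl\<close>.\<close>
  have "(\<lambda>x. x \<oplus>\<^bsub>R\<^esub> add_pow R (2::nat) (teichmueller_sqrt R n (f x))) ` teichmueller_set R n =
      lift_point f ` teich"
    unfolding teichmueller_set_eq using f
    by (intro image_cong)
       (simp_all add: lift_point_def[OF f] f_teich[OF f] add_pow_two teich_closed tsqrt_teich)
  then show ?thesis
    using relative_difference_set_iff_planar[OF f] by simp
qed

end
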